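(* Let $G=(\mathcal V,\mathcal E)$ be a connected bipartite graph (with $|\mathcal V|\ge 2$) of bipartition $\mathcal V=\mathcal V_1\cup\mathcal V_2$. Then $$\mathcal N_{\textsc{b}}(G)=\mathcal W(G),$$ where $$\mathcal N_{\textsc{b}}(G)=\Bigl\{\mu\in\mathcal M(\mathcal V):\ \mu(\mathcal V_1)=\mu(\mathcal V_2)\ \text{ and }\ \mu(U)<\mu(\mathcal E(U))\ \text{ for all } U\subset\mathcal V \text{ with } U\notin\{\emptyset,\mathcal V,\mathcal V_1,\mathcal V_2\}\Bigr\}$$ and $$\mathcal W(G)=\{\mu^\alpha:\alpha\in\mathcal M(\mathcal E)\}.$$
   Context: A graph $G=(\mathcal V,\mathcal E)$ is finite, undirected, without self-loops, with $\mathcal E\subset\mathcal V\times\mathcal V$ symmetric. For $U\subset\mathcal V$, $\mathcal E(U)=\{v\in\mathcal V:\exists u\in U,\ (u,v)\in\mathcal E\}$ and $\mathcal E(u)=\mathcal E(\{u\})$. $\mathcal M(\mathcal V)$ is the set of positive measures with full support on $\mathcal V$. $\mathcal M(\mathcal E)$ is the set of families of weights $\alpha=(\alpha_{i,j})_{(i,j)\in\mathcal E}$ with $\alpha_{i,j}=\alpha_{j,i}>0$; for such $\alpha$, $\mu^\alpha(i)=\sum_{j\in\mathcal E(i)}\alpha_{i,j}$ for $i\in\mathcal V$. *)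

theory Defs
  imports "HOL-Analysis.Analysis" "Graph_Theory.Graph_Theory"
begin

text \<open>
  Graphs are \<open>pair_graph\<close>s: finite, loop-free, without parallel arcs, and with a symmetric
  arc set \<open>parcs G\<close>, a subset of \<open>pverts G \<times> pverts G\<close>. Each undirected edge is thus present
  as two arcs. The neighbourhood of \<open>U\<close> is the relational image \<open>parcs G `` U\<close>.
\<close>

definition bipartition :: "'a pair_pre_digraph \<Rightarrow> 'a set \<Rightarrow> 'a set \<Rightarrow> bool" where
  "bipartition G V1 V2 \<longleftrightarrow>
     V1 \<union> V2 = pverts G \<and> V1 \<inter> V2 = {} \<and>
     parcs G \<subseteq> (V1 \<times> V2) \<union> (V2 \<times> V1)"

text \<open>
  Measures on the finite discrete space \<open>V\<close>. Full support means that every singleton is charged;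
  \<open>finite_measure\<close> excludes infinite masses, which the type \<open>measure\<close> would allow.
\<close>

definition full_support_measures :: "'a set \<Rightarrow> 'a measure set" where
  "full_support_measures V =
     {\<mu>. space \<mu> = V \<and> sets \<mu> = Pow V \<and> finite_measure \<mu> \<and> (\<forall>v\<in>V. 0 < measure \<mu> {v})}"

definition edge_weights :: "'a pair_pre_digraph \<Rightarrow> ('a \<times> 'a \<Rightarrow> real) set" where
  "edge_weights G =
     {\<alpha> \<in> parcs G \<rightarrow>\<^sub>E {0<..}. \<forall>(i, j)\<in>parcs G. \<alpha> (i, j) = \<alpha> (j, i)}"

definition weight_measure :: "'a pair_pre_digraph \<Rightarrow> ('a \<times> 'a \<Rightarrow> real) \<Rightarrow> 'a measure" where
  "weight_measure G \<alpha> =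
     point_measure (pverts G) (\<lambda>i. ennreal (\<Sum>j\<in>parcs G `` {i}. \<alpha> (i, j)))"

definition N_B :: "'a pair_pre_digraph \<Rightarrow> 'a set \<Rightarrow> 'a set \<Rightarrow> 'a measure set" where
  "N_B G V1 V2 =
     {\<mu> \<in> full_support_measures (pverts G).
        measure \<mu> V1 = measure \<mu> V2 \<and>
        (\<forall>U. U \<subseteq> pverts G \<and> U \<notin> {{}, pverts G, V1, V2} \<longrightarrow>
           measure \<mu> U < measure \<mu> (parcs G `` U))}"

definition W :: "'a pair_pre_digraph \<Rightarrow> 'a measure set" where
  "W G = {weight_measure G \<alpha> | \<alpha>. \<alpha> \<in> edge_weights G}"

end

theory Submission
  imports Defs
begin

text \<open>
  The inclusion of \<open>W G\<close> in \<open>N_B G V1 V2\<close> is a double count. By symmetry of \<open>\<alpha>\<close>, the mass of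
  \<open>E(U)\<close> is the total weight of the arcs that end in \<open>E(U)\<close>, and these include all arcs that
  start in \<open>U\<close>. Equality of masses would mean \<open>E(E(U)) \<subseteq> U\<close>; in a connected graph this makes
  \<open>U\<close> contain each colour class that it meets, so \<open>U\<close> is one of the four excluded sets.

  For the converse, weights on the edges with prescribed sums at the vertices are a positive
  transport plan from \<open>V1\<close> to \<open>V2\<close> along the edges. A nonnegative plan exists whenever Hall's
  inequalities \<open>\<mu>(U) \<le> \<mu>(E(U))\<close> hold (lemma \<open>weighted_hall\<close>, a version with real masses of
  the marriage theorem, proved like it by splitting along a tight set). The inequalities in
  \<open>N_B\<close> are strict, and there are finitely many of them, so a small \<open>\<epsilon>\<close> can first be reserved
  for every edge: the residual masses still satisfy Hall's inequalities, and adding the reserve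
  to a nonnegative plan for them makes all edge weights positive (lemma
  \<open>positive_transport\<close>). The set \<open>V1\<close> itself, where there is no strict inequality, causes no
  trouble because the reserve takes the same total mass from both colour classes.
\<close>

section \<open>Transport plans and Hall's condition for real masses\<close>

text \<open>
  Supplies \<open>a\<close> are shipped exactly, while \<open>b\<close> is only a capacity: the pieces into which a problem
  is split in the induction below are not balanced.
\<close>

definition transport_plan ::
    "'a set \<Rightarrow> 'b set \<Rightarrow> ('a \<times> 'b) set \<Rightarrow> ('a \<Rightarrow> real) \<Rightarrow> ('b \<Rightarrow> real) \<Rightarrow> ('a \<times> 'b \<Rightarrow> real) \<Rightarrow> bool"
  where
  "transport_plan A B R a b f \<longleftrightarrow>
     (\<forall>p. 0 \<le> f p) \<and> (\<forall>p. p \<notin> R \<longrightarrow> f p = 0) \<and>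
     (\<forall>x\<in>A. (\<Sum>y\<in>B. f (x, y)) = a x) \<and> (\<forall>y\<in>B. (\<Sum>x\<in>A. f (x, y)) \<le> b y)"

lemma transport_plan_insert_zero:
  assumes f: "transport_plan (A - {x}) B (R \<inter> (A - {x}) \<times> B) a b f"
    and "finite A" "x \<in> A" "a x = 0"
  shows "transport_plan A B R a b f"
proof -
  have z: "f (x, y) = 0" for y
    using f by (auto simp: transport_plan_def)
  have "(\<Sum>x'\<in>A. f (x', y)) = (\<Sum>x'\<in>A - {x}. f (x', y))" for y
    using assms(2,3) by (simp add: sum.remove z)
  then show ?thesis
    using f z assms(4) unfolding transport_plan_def by auto
qed

lemma transport_plan_add_edge:
  assumes f: "transport_plan A B R (a(x := a x - t)) (b(y := b y - t)) f"
    and "finite A" "finite B" "x \<in> A" "y \<in> B" "(x, y) \<in> R" "0 \<le> t"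
  shows "transport_plan A B R a b (\<lambda>p. f p + (if p = (x, y) then t else 0))"
proof -
  have row: "(\<Sum>y'\<in>B. if (x', y') = (x, y) then t else 0) = (if x' = x then t else 0)" for x'
    using assms(3,5) by (cases "x' = x") simp_all
  have col: "(\<Sum>x'\<in>A. if (x', y') = (x, y) then t else 0) = (if y' = y then t else 0)" for y'
    using assms(2,4) by (cases "y' = y") simp_all
  have "(\<Sum>y'\<in>B. f (x', y')) + (if x' = x then t else 0) = a x'" if "x' \<in> A" for x'
    using f that by (auto simp: transport_plan_def)
  moreover have "(\<Sum>x'\<in>A. f (x', y')) + (if y' = y then t else 0) \<le> b y'" if "y' \<in> B" for y'
    using bspec[of B _ y'] f that by (fastforce simp: transport_plan_def)
  ultimately show ?thesis
    using f assms(6,7) unfolding transport_plan_def sum.distrib row col by auto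
qed

text \<open>
  The plan for \<open>U\<close> only uses targets in \<open>R `` U\<close> and the plan for the rest avoids them, so the
  two do not compete for capacity.
\<close>

lemma transport_plan_union:
  assumes f: "transport_plan U B (R \<inter> U \<times> B) a b f"
    and g: "transport_plan (A - U) B (R \<inter> (A - U) \<times> (B - R `` U)) a b g"
    and "finite A" "U \<subseteq> A"
  shows "transport_plan A B R a b (\<lambda>p. f p + g p)"
proof -
  have f0: "f (x, y) = 0" if "x \<notin> U \<or> y \<notin> R `` U" for x y
    using f that unfolding transport_plan_def by blast
  have g0: "g (x, y) = 0" if "x \<in> U \<or> y \<in> R `` U" for x y
    using g that unfolding transport_plan_def by blast
  have row: "(\<Sum>y\<in>B. f (x, y) + g (x, y)) = a x" if "x \<in> A" for x
    using f g that f0[of x] g0[of x] by (cases "x \<in> U") (auto simp: transport_plan_def)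
  have col: "(\<Sum>x\<in>A. f (x, y) + g (x, y)) \<le> b y" if y: "y \<in> B" for y
  proof (cases "y \<in> R `` U")
    case True
    then have "(\<Sum>x\<in>A. f (x, y) + g (x, y)) = (\<Sum>x\<in>U. f (x, y))"
      using assms(3,4) f0 g0 by (intro sum.mono_neutral_cong_right) auto
    then show ?thesis
      using f y by (auto simp: transport_plan_def)
  next
    case False
    then have "(\<Sum>x\<in>A. f (x, y) + g (x, y)) = (\<Sum>x\<in>A - U. g (x, y))"
      using assms(3,4) f0 g0 by (intro sum.mono_neutral_cong_right) auto
    then show ?thesis
      using g y by (auto simp: transport_plan_def)
  qed
  show ?thesis
    using f g row col unfolding transport_plan_def by auto
qed

text \<open>
  Along one arc \<open>(x, y)\<close> as much mass \<open>t\<close> is sent as Hall's condition for the remaining masses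
  permits. What stops \<open>t\<close> from growing is that \<open>x\<close> is exhausted, that \<open>y\<close> is saturated, or
  that some nonempty proper subset \<open>U\<close> of \<open>A\<close> has become tight. The problem then shrinks: \<open>x\<close>
  can be deleted, the arc can be deleted, or the problem splits into one for \<open>U\<close> and one for
  \<open>A - U\<close>, where tightness of \<open>U\<close> is what gives Hall's condition for \<open>A - U\<close>.
\<close>

lemma weighted_hall:
  fixes a :: "'a \<Rightarrow> real" and b :: "'b \<Rightarrow> real"
  assumes "finite A" "finite B" "R \<subseteq> A \<times> B"
    and "\<And>x. x \<in> A \<Longrightarrow> 0 \<le> a x" "\<And>y. y \<in> B \<Longrightarrow> 0 \<le> b y"
    and "\<And>U. U \<subseteq> A \<Longrightarrow> sum a U \<le> sum b (R `` U)"
  shows "\<exists>f. transport_plan A B R a b f"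
  using assms(1,3-6)
proof (induction "card A + card R" arbitrary: A R a b rule: less_induct)
  case less
  note finA = less.prems(1) and RAB = less.prems(2) and hall = less.prems(5)
  note finB = \<open>finite B\<close>
  have finR: "finite R"
    using RAB finA finB by (meson finite_SigmaI finite_subset)
  have finI: "finite (R `` U)" for U
    using RAB finB by (auto intro: finite_subset[of _ B])
  have IH: "\<exists>f. transport_plan A' B R' a' b' f"
    if "card A' + card R' < card A + card R" "A' \<subseteq> A" "R' \<subseteq> A' \<times> B"
      "\<And>x. x \<in> A \<Longrightarrow> 0 \<le> a' x" "\<And>y. y \<in> B \<Longrightarrow> 0 \<le> b' y"
      "\<And>U. U \<subseteq> A' \<Longrightarrow> sum a' U \<le> sum b' (R' `` U)" for A' R' a' b'
    by (rule less.hyps[OF that(1) finite_subset[OF that(2) finA] that(3) _ that(5,6)])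
      (use that(2,4) in blast)+
  have delete_source: "\<exists>f. transport_plan A B R a' b' f"
    if "x \<in> A" "a' x = 0" "\<And>x. x \<in> A \<Longrightarrow> 0 \<le> a' x" "\<And>y. y \<in> B \<Longrightarrow> 0 \<le> b' y"
      "\<And>U. U \<subseteq> A \<Longrightarrow> sum a' U \<le> sum b' (R `` U)" for x a' b'
  proof -
    let ?R = "R \<inter> (A - {x}) \<times> B"
    have "card (A - {x}) < card A"
      using that(1) finA by (rule card_Diff1_less[rotated])
    moreover have "card ?R \<le> card R"
      by (rule card_mono[OF finR]) auto
    ultimately have smaller: "card (A - {x}) + card ?R < card A + card R"
      by linarith
    have "sum a' U \<le> sum b' (?R `` U)" if "U \<subseteq> A - {x}" for U
    proof -
      have "?R `` U = R `` U"
        using that RAB by blast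
      then show ?thesis
        using that \<open>\<And>U. U \<subseteq> A \<Longrightarrow> sum a' U \<le> sum b' (R `` U)\<close>[of U] by auto
    qed
    from IH[OF smaller Diff_subset Int_lower2 that(3,4) this]
    show ?thesis
      using transport_plan_insert_zero[of A x B R a' b'] finA that(1,2) by blast
  qed
  show ?case
  proof (cases "A = {}")
    case True
    then have "transport_plan A B R a b (\<lambda>_. 0)"
      using less.prems(4) by (simp add: transport_plan_def)
    then show ?thesis by blast
  next
    case False
    then obtain x where x: "x \<in> A" by blast
    show ?thesis
    proof (cases "R `` {x} = {}")
      case True
      then have "a x = 0"
        using hall[of "{x}"] less.prems(3)[OF x] x by simp
      then show ?thesis
        by (rule delete_source[OF x _ less.prems(3-5)])
    next
      case False
      then obtain y where xy: "(x, y) \<in> R" by blast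
      then have y: "y \<in> B" using RAB by blast
      let ?F = "{U. U \<subseteq> A \<and> x \<notin> U \<and> y \<in> R `` U}"
      let ?slack = "\<lambda>U. sum b (R `` U) - sum a U"
      define S where "S = insert (a x) (insert (b y) (?slack ` ?F))"
      define t where "t = Min S"
      have finS: "finite S"
        using finA by (auto simp: S_def)
      have "t \<in> S"
        unfolding t_def by (rule Min_in) (use finS in \<open>auto simp: S_def\<close>)
      have le: "t \<le> s" if "s \<in> S" for s
        unfolding t_def using finS that by simp
      have "0 \<le> s" if "s \<in> S" for s
        using that less.prems(3)[OF x] less.prems(4)[OF y] hall by (auto simp: S_def)
      then have t0: "0 \<le> t"
        using \<open>t \<in> S\<close> by blast
      define a' where "a' = a(x := a x - t)"
      define b' where "b' = b(y := b y - t)"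
      have a'0: "0 \<le> a' z" if "z \<in> A" for z
        using le[of "a x"] less.prems(3)[OF that] by (auto simp: a'_def S_def)
      have b'0: "0 \<le> b' z" if "z \<in> B" for z
        using le[of "b y"] less.prems(4)[OF that] by (auto simp: b'_def S_def)
      have sa: "sum a' U = sum a U - (if x \<in> U then t else 0)" if "U \<subseteq> A" for U
      proof -
        have "a' = (\<lambda>z. a z - (if z = x then t else 0))"
          by (auto simp: a'_def)
        then show ?thesis
          using finite_subset[OF that finA] by (simp add: sum_subtractf sum.delta)
      qed
      have sb: "sum b' Y = sum b Y - (if y \<in> Y then t else 0)" if "finite Y" for Y
      proof -
        have "b' = (\<lambda>z. b z - (if z = y then t else 0))"
          by (auto simp: b'_def)
        then show ?thesis
          using that by (simp add: sum_subtractf sum.delta)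
      qed
      have hall': "sum a' U \<le> sum b' (R `` U)" if U: "U \<subseteq> A" for U
      proof (cases "x \<in> U")
        case True
        then have "y \<in> R `` U" using xy by blast
        then show ?thesis
          using hall[OF U] sa[OF U] sb[OF finI[of U]] True by simp
      next
        case False
        then have "y \<in> R `` U \<Longrightarrow> t \<le> ?slack U"
          using le U by (auto simp: S_def)
        then show ?thesis
          using hall[OF U] sa[OF U] sb[OF finI[of U]] False by (simp split: if_splits)
      qed
      have "\<exists>f. transport_plan A B R a' b' f"
      proof -
        consider "t = a x" | "t = b y" | U where "U \<in> ?F" "t = ?slack U"
          using \<open>t \<in> S\<close> by (auto simp: S_def)
        then show ?thesis
        proof cases
          case 1
          then have "a' x = 0" by (simp add: a'_def)
          then show ?thesis
            by (rule delete_source[OF x _ a'0 b'0 hall'])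
        next
          case 2
          let ?R = "R - {(x, y)}"
          have b'y: "b' y = 0"
            using 2 by (simp add: b'_def)
          have "card ?R < card R"
            using xy finR by (rule card_Diff1_less[rotated])
          then have smaller: "card A + card ?R < card A + card R"
            by linarith
          have R: "?R \<subseteq> A \<times> B"
            using RAB by blast
          have "sum a' U \<le> sum b' (?R `` U)" if "U \<subseteq> A" for U
          proof -
            have "sum b' (?R `` U) = sum b' (R `` U)"
              using b'y finI[of U] by (intro sum.mono_neutral_left) auto
            then show ?thesis
              using hall'[OF that] by simp
          qed
          from IH[OF smaller subset_refl R a'0 b'0 this]
          obtain f where "transport_plan A B ?R a' b' f" ..
          then have "transport_plan A B R a' b' f"
            by (simp add: transport_plan_def)
          then show ?thesis by blast
        next
          case 3
          then have U: "U \<subseteq> A" "x \<notin> U" "y \<in> R `` U" by auto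
          then have tight: "sum a' U = sum b' (R `` U)"
            using 3(2) sa[OF U(1)] sb[OF finI[of U]] by simp
          have "U \<noteq> {}" "U \<noteq> A" using U x by auto
          let ?R1 = "R \<inter> U \<times> B"
          let ?R2 = "R \<inter> (A - U) \<times> (B - R `` U)"
          have c: "card ?R1 \<le> card R" "card ?R2 \<le> card R"
            by (auto intro: card_mono[OF finR])
          have "card U < card A"
            using U(1) \<open>U \<noteq> A\<close> finA by (intro psubset_card_mono) auto
          then have smaller1: "card U + card ?R1 < card A + card R"
            using c by linarith
          have "sum a' W \<le> sum b' (?R1 `` W)" if "W \<subseteq> U" for W
          proof -
            have "?R1 `` W = R `` W"
              using that RAB by blast
            then show ?thesis
              using hall'[of W] that U(1) by auto
          qed
          from IH[OF smaller1 U(1) Int_lower2 a'0 b'0 this]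
          obtain f where f: "transport_plan U B ?R1 a' b' f" ..
          have "card (A - U) < card A"
            using U(1) \<open>U \<noteq> {}\<close> finA by (intro psubset_card_mono) auto
          then have smaller2: "card (A - U) + card ?R2 < card A + card R"
            using c by linarith
          have R2: "?R2 \<subseteq> (A - U) \<times> B"
            by blast
          have "sum a' W \<le> sum b' (?R2 `` W)" if W: "W \<subseteq> A - U" for W
          proof -
            have "?R2 `` W = R `` W - R `` U"
              using W RAB by blast
            moreover have "R `` (W \<union> U) = (R `` W - R `` U) \<union> R `` U"
              by blast
            ultimately have "sum b' (R `` (W \<union> U)) = sum b' (?R2 `` W) + sum b' (R `` U)"
              using sum.union_disjoint[of "R `` W - R `` U" "R `` U" b'] finI Diff_disjoint
              by (metis Int_commute finite_Diff)
            moreover have "sum a' (W \<union> U) = sum a' W + sum a' U"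
              using W U(1) finA by (intro sum.union_disjoint) (auto intro: finite_subset)
            moreover have "sum a' (W \<union> U) \<le> sum b' (R `` (W \<union> U))"
              using W U(1) by (intro hall') auto
            ultimately show ?thesis
              using tight by linarith
          qed
          from IH[OF smaller2 Diff_subset R2 a'0 b'0 this]
          show ?thesis
            using transport_plan_union[OF f _ finA U(1)] by blast
        qed
      qed
      then show ?thesis
        using transport_plan_add_edge[of A B R a x t b y] finA finB x y xy t0
        unfolding a'_def b'_def by blast
    qed
  qed
qed

text \<open>
  The reserve \<open>\<epsilon>\<close> per arc lowers any sum of masses by at most \<open>\<epsilon>\<close> times the number \<open>c\<close> of
  arcs, so it only has to keep \<open>\<epsilon> * c\<close> below all masses and all gaps in Hall's inequalities.
\<close>

lemma positive_transport:
  fixes a :: "'a \<Rightarrow> real" and b :: "'b \<Rightarrow> real"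
  assumes finA: "finite A" and finB: "finite B" and RAB: "R \<subseteq> A \<times> B"
    and a: "\<And>x. x \<in> A \<Longrightarrow> 0 < a x" and b: "\<And>y. y \<in> B \<Longrightarrow> 0 < b y"
    and onto: "R `` A = B" and balanced: "sum a A = sum b B"
    and strict: "\<And>U. U \<subseteq> A \<Longrightarrow> U \<noteq> {} \<Longrightarrow> U \<noteq> A \<Longrightarrow> sum a U < sum b (R `` U)"
  shows "\<exists>f. (\<forall>p\<in>R. 0 < f p) \<and> (\<forall>p. p \<notin> R \<longrightarrow> f p = 0) \<and>
    (\<forall>x\<in>A. (\<Sum>y\<in>B. f (x, y)) = a x) \<and> (\<forall>y\<in>B. (\<Sum>x\<in>A. f (x, y)) = b y)"
proof -
  let ?one = "\<lambda>p. if p \<in> R then 1 else (0::real)"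
  define da where "da x = (\<Sum>y\<in>B. ?one (x, y))" for x
  define db where "db y = (\<Sum>x\<in>A. ?one (x, y))" for y
  define c where "c = sum da A"
  have c_eq: "c = sum db B"
    unfolding c_def da_def db_def by (rule sum.swap)
  have da0: "0 \<le> da x" for x
    by (simp add: da_def sum_nonneg)
  have db0: "0 \<le> db y" for y
    by (simp add: db_def sum_nonneg)
  have c0: "0 \<le> c"
    by (simp add: c_def da0 sum_nonneg)
  let ?F = "{U. U \<subseteq> A \<and> U \<noteq> {} \<and> U \<noteq> A}"
  \<comment> \<open>The element 1 makes the minimum meaningful also when both sides are empty.\<close>
  define S where "S = insert 1 (a ` A \<union> b ` B \<union> (\<lambda>U. sum b (R `` U) - sum a U) ` ?F)"
  have finS: "finite S"
    using finA finB by (auto simp: S_def)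
  have pos: "0 < s" if "s \<in> S" for s
    using that unfolding S_def by (elim insertE UnE imageE) (simp_all add: a b strict)
  define \<epsilon> where "\<epsilon> = Min S / (c + 1)"
  have "Min S \<in> S"
    by (rule Min_in) (use finS in \<open>auto simp: S_def\<close>)
  then have \<epsilon>0: "0 < \<epsilon>"
    using pos c0 by (simp add: \<epsilon>_def)
  have \<epsilon>c: "\<epsilon> * c \<le> s" if "s \<in> S" for s
  proof -
    have "\<epsilon> * c \<le> \<epsilon> * (c + 1)"
      using \<epsilon>0 by simp
    also have "\<dots> = Min S"
      using c0 by (simp add: \<epsilon>_def)
    also have "\<dots> \<le> s"
      using finS that by simp
    finally show ?thesis .
  qed
  define a' where "a' x = a x - \<epsilon> * da x" for x
  define b' where "b' y = b y - \<epsilon> * db y" for y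
  have sa: "sum a' U = sum a U - \<epsilon> * sum da U" for U
    by (simp add: a'_def sum_subtractf sum_distrib_left)
  have sb: "sum b' U = sum b U - \<epsilon> * sum db U" for U
    by (simp add: b'_def sum_subtractf sum_distrib_left)
  have a'0: "0 \<le> a' x" if x: "x \<in> A" for x
  proof -
    have "da x \<le> c"
      unfolding c_def by (rule member_le_sum) (use x finA da0 in auto)
    then have "\<epsilon> * da x \<le> \<epsilon> * c"
      using \<epsilon>0 by simp
    also have "\<dots> \<le> a x"
      using x by (intro \<epsilon>c) (auto simp: S_def)
    finally show ?thesis by (simp add: a'_def)
  qed
  have b'0: "0 \<le> b' y" if y: "y \<in> B" for y
  proof -
    have "db y \<le> c"
      unfolding c_eq by (rule member_le_sum) (use y finB db0 in auto)
    then have "\<epsilon> * db y \<le> \<epsilon> * c"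
      using \<epsilon>0 by simp
    also have "\<dots> \<le> b y"
      using y by (intro \<epsilon>c) (auto simp: S_def)
    finally show ?thesis by (simp add: b'_def)
  qed
  have balanced': "sum a' A = sum b' B"
    using balanced c_eq by (simp add: sa sb c_def)
  have hall': "sum a' U \<le> sum b' (R `` U)" if U: "U \<subseteq> A" for U
  proof -
    consider "U = {}" | "U = A" | "U \<in> ?F"
      using U by auto
    then show ?thesis
    proof cases
      case 3
      then have "\<epsilon> * c \<le> sum b (R `` U) - sum a U"
        by (intro \<epsilon>c) (auto simp: S_def)
      moreover have "sum db (R `` U) \<le> c"
        unfolding c_eq by (rule sum_mono2) (use finB RAB db0 in auto)
      then have "\<epsilon> * sum db (R `` U) \<le> \<epsilon> * c"
        using \<epsilon>0 by simp
      moreover have "0 \<le> \<epsilon> * sum da U"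
        using \<epsilon>0 da0 by (simp add: sum_nonneg)
      ultimately show ?thesis
        by (simp add: sa sb)
    qed (use balanced' onto in auto)
  qed
  have "\<exists>f. transport_plan A B R a' b' f"
    by (rule weighted_hall[OF finA finB RAB a'0 b'0 hall'])
  then obtain f where f: "transport_plan A B R a' b' f" ..
  have row: "(\<Sum>y\<in>B. f (x, y)) = a' x" if "x \<in> A" for x
    using f that by (auto simp: transport_plan_def)
  have col_le: "(\<Sum>x\<in>A. f (x, y)) \<le> b' y" if "y \<in> B" for y
    using f that by (auto simp: transport_plan_def)
  have "(\<Sum>y\<in>B. \<Sum>x\<in>A. f (x, y)) = (\<Sum>x\<in>A. \<Sum>y\<in>B. f (x, y))"
    by (rule sum.swap)
  also have "\<dots> = sum b' B"
    using row balanced' by simp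
  \<comment> \<open>All of the supply is shipped and it equals the demand, so no demand is left open.\<close>
  finally have col: "(\<Sum>x\<in>A. f (x, y)) = b' y" if "y \<in> B" for y
    using sum_mono_inv[of "\<lambda>y. \<Sum>x\<in>A. f (x, y)" B b'] col_le that finB by blast
  show ?thesis
  proof (intro exI[of _ "\<lambda>p. f p + \<epsilon> * ?one p"] conjI ballI allI impI)
    show "0 < f p + \<epsilon> * ?one p" if "p \<in> R" for p
      using that f \<epsilon>0 by (cases p) (auto simp: transport_plan_def add_nonneg_pos)
    show "f p + \<epsilon> * ?one p = 0" if "p \<notin> R" for p
      using that f by (cases p) (auto simp: transport_plan_def)
    show "(\<Sum>y\<in>B. f (x, y) + \<epsilon> * ?one (x, y)) = a x" if "x \<in> A" for x
      using row[OF that] unfolding sum.distrib sum_distrib_left[symmetric] da_def[symmetric]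
      by (simp add: a'_def)
    show "(\<Sum>x\<in>A. f (x, y) + \<epsilon> * ?one (x, y)) = b y" if "y \<in> B" for y
      using col[OF that] unfolding sum.distrib sum_distrib_left[symmetric] db_def[symmetric]
      by (simp add: b'_def)
  qed
qed

section \<open>Closed vertex sets in connected bipartite graphs\<close>

lemma connected_closed_set:
  assumes "pair_graph G" "Digraph_Component.connected (with_proj G)"
    and "u \<in> C" "u \<in> pverts G" "parcs G `` C \<subseteq> C"
  shows "pverts G \<subseteq> C"
proof
  fix v assume v: "v \<in> pverts G"
  interpret pair_graph G by fact
  have "strongly_connected (with_proj G)"
    using symmetric_connected_imp_strongly_connected[OF sym_arcs assms(2)] .
  then have "u \<rightarrow>\<^sup>*\<^bsub>with_proj G\<^esub> v"
    using v assms(4) by (auto simp: strongly_connected_def)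
  then show "v \<in> C"
  proof (induction rule: reachable_induct)
    case base
    show ?case by (rule assms(3))
  next
    case (step x y)
    then have "(x, y) \<in> parcs G" by simp
    then show ?case using step.IH assms(5) by blast
  qed
qed

lemma connected_no_isolated:
  assumes "pair_graph G" "Digraph_Component.connected (with_proj G)"
    and "card (pverts G) \<ge> 2" "v \<in> pverts G"
  shows "parcs G `` {v} \<noteq> {}"
proof
  assume "parcs G `` {v} = {}"
  then have "pverts G \<subseteq> {v}"
    using connected_closed_set[OF assms(1,2), of v "{v}"] assms(4) by blast
  then have "card (pverts G) \<le> card {v}"
    by (intro card_mono) auto
  then show False using assms(3) by simp
qed

text \<open>
  In a bipartite graph two steps return to the colour class of the start, so the part of \<open>U\<close> in
  \<open>V1\<close> together with its neighbours in \<open>V2\<close> is closed under single steps.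
\<close>

lemma two_step_closed_contains_class:
  assumes "pair_graph G" "Digraph_Component.connected (with_proj G)"
    and bip: "bipartition G V1 V2"
    and closed: "parcs G `` (parcs G `` U) \<subseteq> U" and ne: "U \<inter> V1 \<noteq> {}"
  shows "V1 \<subseteq> U"
proof -
  from ne obtain u where u: "u \<in> U" "u \<in> V1" by blast
  let ?C = "(U \<inter> V1) \<union> parcs G `` (U \<inter> V1)"
  have "parcs G `` ?C \<subseteq> ?C"
    using closed bip unfolding bipartition_def by blast
  then have "pverts G \<subseteq> ?C"
    using connected_closed_set[OF assms(1,2), of u ?C] u bip unfolding bipartition_def by blast
  then show ?thesis
    using bip unfolding bipartition_def by blast
qed

lemma two_step_closed_cases:
  assumes "pair_graph G" "Digraph_Component.connected (with_proj G)"
    and bip: "bipartition G V1 V2"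
    and "parcs G `` (parcs G `` U) \<subseteq> U" "U \<subseteq> pverts G"
  shows "U \<in> {{}, pverts G, V1, V2}"
proof -
  have "bipartition G V2 V1"
    using bip by (auto simp: bipartition_def)
  then have "U \<inter> V2 \<noteq> {} \<Longrightarrow> V2 \<subseteq> U" and "U \<inter> V1 \<noteq> {} \<Longrightarrow> V1 \<subseteq> U"
    using two_step_closed_contains_class[OF assms(1,2)] assms(3,4) by auto
  moreover have "V1 \<union> V2 = pverts G"
    using bip by (simp add: bipartition_def)
  ultimately show ?thesis
    using assms(5) by (cases "U \<inter> V1 = {}"; cases "U \<inter> V2 = {}") auto
qed

section \<open>Measures induced by edge weights\<close>

lemma edge_weights_pos:
  "\<alpha> \<in> edge_weights G \<Longrightarrow> p \<in> parcs G \<Longrightarrow> 0 < \<alpha> p"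
  by (auto simp: edge_weights_def)

lemma finite_parcs_Image:
  assumes "pair_graph G"
  shows "finite (parcs G `` U)"
proof -
  interpret pair_graph G by fact
  show ?thesis
    by (rule finite_Image) (rule pair_finite_arcs)
qed

lemma emeasure_weight_measure:
  assumes "pair_graph G" "\<alpha> \<in> edge_weights G" "U \<subseteq> pverts G"
  shows "emeasure (weight_measure G \<alpha>) U = ennreal (\<Sum>p\<in>{p \<in> parcs G. fst p \<in> U}. \<alpha> p)"
proof -
  interpret pair_graph G by fact
  have finU: "finite U"
    using assms(3) by (rule finite_subset) (rule pair_finite_verts)
  have "emeasure (weight_measure G \<alpha>) U
      = (\<Sum>i\<in>U. ennreal (\<Sum>j\<in>parcs G `` {i}. \<alpha> (i, j)))"
    unfolding weight_measure_def
    by (rule emeasure_point_measure_finite) (use assms(3) pair_finite_verts in auto)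
  also have "\<dots> = ennreal (\<Sum>i\<in>U. \<Sum>j\<in>parcs G `` {i}. \<alpha> (i, j))"
    by (rule sum_ennreal) (intro sum_nonneg less_imp_le[OF edge_weights_pos[OF assms(2)]], auto)
  also have "(\<Sum>i\<in>U. \<Sum>j\<in>parcs G `` {i}. \<alpha> (i, j))
      = sum \<alpha> (Sigma U (\<lambda>i. parcs G `` {i}))"
    using sum.Sigma[of U "\<lambda>i. parcs G `` {i}" "\<lambda>i j. \<alpha> (i, j)"] finU
      finite_parcs_Image[OF assms(1)] by simp
  also have "Sigma U (\<lambda>i. parcs G `` {i}) = {p \<in> parcs G. fst p \<in> U}"
    by auto
  finally show ?thesis .
qed

lemma measure_weight_measure:
  assumes "pair_graph G" "\<alpha> \<in> edge_weights G" "U \<subseteq> pverts G"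
  shows "measure (weight_measure G \<alpha>) U = (\<Sum>p\<in>{p \<in> parcs G. fst p \<in> U}. \<alpha> p)"
proof -
  have "0 \<le> (\<Sum>p\<in>{p \<in> parcs G. fst p \<in> U}. \<alpha> p)"
    by (intro sum_nonneg less_imp_le[OF edge_weights_pos[OF assms(2)]]) auto
  then show ?thesis
    by (simp add: measure_def emeasure_weight_measure[OF assms])
qed

lemma sum_edge_weights_swap:
  assumes "pair_graph G" "\<alpha> \<in> edge_weights G"
  shows "(\<Sum>p\<in>{p \<in> parcs G. fst p \<in> U}. \<alpha> p) = (\<Sum>p\<in>{p \<in> parcs G. snd p \<in> U}. \<alpha> p)"
proof -
  interpret pair_graph G by fact
  show ?thesis
    by (rule sum.reindex_bij_witness[of _ prod.swap prod.swap])
      (use assms(2) arcs_symmetric in \<open>auto simp: edge_weights_def\<close>)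
qed

lemma weight_measure_in_N_B:
  assumes G: "pair_graph G" and conn: "Digraph_Component.connected (with_proj G)"
    and card: "card (pverts G) \<ge> 2" and bip: "bipartition G V1 V2"
    and \<alpha>: "\<alpha> \<in> edge_weights G"
  shows "weight_measure G \<alpha> \<in> N_B G V1 V2"
proof -
  interpret pair_graph G by fact
  let ?M = "weight_measure G \<alpha>"
  let ?out = "\<lambda>U. {p \<in> parcs G. fst p \<in> U}"
  let ?into = "\<lambda>U. {p \<in> parcs G. snd p \<in> U}"
  have fin: "finite {p \<in> parcs G. P p}" for P
    using pair_finite_arcs by simp
  note meas = measure_weight_measure[OF G \<alpha>]
  have PV: "parcs G `` U \<subseteq> pverts G" for U
    using bip by (auto simp: bipartition_def)
  have space: "space ?M = pverts G" "sets ?M = Pow (pverts G)"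
    by (simp_all add: weight_measure_def space_point_measure sets_point_measure)
  have "finite_measure ?M"
    by (rule finite_measureI)
      (simp add: space emeasure_weight_measure[OF G \<alpha>])
  moreover have "0 < measure ?M {v}" if v: "v \<in> pverts G" for v
  proof -
    have "?out {v} \<noteq> {}"
      using connected_no_isolated[OF G conn card v] by auto
    then have "0 < sum \<alpha> (?out {v})"
      using fin edge_weights_pos[OF \<alpha>] by (intro sum_pos) auto
    then show ?thesis
      using v by (simp add: meas)
  qed
  moreover have "measure ?M V1 = measure ?M V2"
  proof -
    have "?into V1 = ?out V2"
      using bip unfolding bipartition_def by fastforce
    moreover have "V1 \<subseteq> pverts G" "V2 \<subseteq> pverts G"
      using bip by (auto simp: bipartition_def)
    ultimately show ?thesis
      using sum_edge_weights_swap[OF G \<alpha>, of V1] by (simp add: meas)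
  qed
  moreover have "measure ?M U < measure ?M (parcs G `` U)"
    if U: "U \<subseteq> pverts G" "U \<notin> {{}, pverts G, V1, V2}" for U
  proof -
    have "\<not> parcs G `` (parcs G `` U) \<subseteq> U"
      using two_step_closed_cases[OF G conn bip _ U(1)] U(2) by blast
    then obtain i j where "j \<in> parcs G `` U" "(j, i) \<in> parcs G" "i \<notin> U"
      by blast
    then have ij: "(i, j) \<in> ?into (parcs G `` U) - ?out U"
      using arcs_symmetric by auto
    have "sum \<alpha> (?out U) < sum \<alpha> (?into (parcs G `` U))"
      by (rule sum_strict_mono2[OF fin _ ij])
        (use ij edge_weights_pos[OF \<alpha>] in \<open>auto intro: less_imp_le\<close>)
    then show ?thesis
      using U(1) PV[of U] sum_edge_weights_swap[OF G \<alpha>, of "parcs G `` U"] by (simp add: meas)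
  qed
  ultimately show ?thesis
    using space by (simp add: N_B_def full_support_measures_def)
qed

section \<open>The characterisation\<close>

lemma N_B_imp_weight_measure:
  assumes G: "pair_graph G" and conn: "Digraph_Component.connected (with_proj G)"
    and card: "card (pverts G) \<ge> 2" and bip: "bipartition G V1 V2"
    and M: "M \<in> N_B G V1 V2"
  shows "\<exists>\<alpha>\<in>edge_weights G. M = weight_measure G \<alpha>"
proof -
  interpret pair_graph G by fact
  have setsM: "sets M = Pow (pverts G)" and "finite_measure M"
    and pos: "\<And>v. v \<in> pverts G \<Longrightarrow> 0 < measure M {v}"
    and eq: "measure M V1 = measure M V2"
    and strict: "\<And>U. U \<subseteq> pverts G \<Longrightarrow> U \<notin> {{}, pverts G, V1, V2} \<Longrightarrow>
      measure M U < measure M (parcs G `` U)"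
    using M by (auto simp: N_B_def full_support_measures_def)
  interpret M: finite_measure M by fact
  have V: "V1 \<union> V2 = pverts G" "V1 \<inter> V2 = {}" "parcs G \<subseteq> V1 \<times> V2 \<union> V2 \<times> V1"
    using bip by (auto simp: bipartition_def)
  have fin: "finite V1" "finite V2"
    using V(1) pair_finite_verts by (auto intro: finite_subset)
  define m where "m v = measure M {v}" for v
  have meas: "measure M U = sum m U" if "U \<subseteq> pverts G" for U
    unfolding m_def
    by (rule M.finite_measure_eq_sum_singleton)
      (use that setsM pair_finite_verts in \<open>auto intro: finite_subset\<close>)
  define R where "R = parcs G \<inter> V1 \<times> V2"
  have R_Image: "R `` U = parcs G `` U" if "U \<subseteq> V1" for U
    using that V unfolding R_def by blast
  have onto: "R `` V1 = V2"
  proof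
    show "V2 \<subseteq> R `` V1"
    proof
      fix v assume v: "v \<in> V2"
      then obtain w where "(v, w) \<in> parcs G"
        using connected_no_isolated[OF G conn card, of v] V(1) by blast
      then show "v \<in> R `` V1"
        using v V arcs_symmetric unfolding R_def by blast
    qed
  qed (auto simp: R_def)
  have strict_R: "sum m U < sum m (R `` U)" if U: "U \<subseteq> V1" "U \<noteq> {}" "U \<noteq> V1" for U
  proof -
    have "U \<subseteq> pverts G" "U \<notin> {{}, pverts G, V1, V2}"
      using U V by auto
    moreover have "parcs G `` U \<subseteq> pverts G"
      using V by auto
    ultimately show ?thesis
      using strict[of U] by (simp add: meas R_Image[OF U(1)])
  qed
  have balanced: "sum m V1 = sum m V2"
    using eq meas[of V1] meas[of V2] V(1) by (metis Un_upper1 Un_upper2)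
  have m1: "0 < m v" if "v \<in> V1" for v
    using pos that V(1) by (auto simp: m_def)
  have m2: "0 < m v" if "v \<in> V2" for v
    using pos that V(1) by (auto simp: m_def)
  have "R \<subseteq> V1 \<times> V2"
    by (simp add: R_def)
  then have "\<exists>f. (\<forall>p\<in>R. 0 < f p) \<and> (\<forall>p. p \<notin> R \<longrightarrow> f p = 0) \<and>
      (\<forall>x\<in>V1. (\<Sum>y\<in>V2. f (x, y)) = m x) \<and> (\<forall>y\<in>V2. (\<Sum>x\<in>V1. f (x, y)) = m y)"
    by (rule positive_transport[OF fin _ m1 m2 onto balanced strict_R])
  then obtain f where f_all: "\<forall>p\<in>R. 0 < f p" "\<forall>p. p \<notin> R \<longrightarrow> f p = 0"
    "\<forall>x\<in>V1. (\<Sum>y\<in>V2. f (x, y)) = m x" "\<forall>y\<in>V2. (\<Sum>x\<in>V1. f (x, y)) = m y"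
    by (elim exE conjE)
  note f = bspec[OF f_all(1)] mp[OF spec[OF f_all(2)]] bspec[OF f_all(3)] bspec[OF f_all(4)]
  \<comment> \<open>The plan only knows the arcs from \<open>V1\<close> to \<open>V2\<close>; the reversed arcs copy their weights.\<close>
  define \<alpha> where "\<alpha> = (\<lambda>p\<in>parcs G. if fst p \<in> V1 then f p else f (prod.swap p))"
  have R1: "p \<in> R" if "p \<in> parcs G" "fst p \<in> V1" for p
    using that V unfolding R_def by (cases p) auto
  have R2: "prod.swap p \<in> R" if "p \<in> parcs G" "fst p \<notin> V1" for p
    using that V arcs_symmetric unfolding R_def by (cases p) auto
  have "\<alpha> \<in> parcs G \<rightarrow>\<^sub>E {0<..}"
    using f(1) R1 R2 by (auto simp: \<alpha>_def)
  moreover have "\<alpha> (i, j) = \<alpha> (j, i)" if "(i, j) \<in> parcs G" for i j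
    using that V arcs_symmetric[OF that] by (auto simp: \<alpha>_def)
  ultimately have \<alpha>: "\<alpha> \<in> edge_weights G"
    by (auto simp: edge_weights_def)
  have row: "(\<Sum>j\<in>parcs G `` {i}. \<alpha> (i, j)) = m i" if i: "i \<in> pverts G" for i
  proof (cases "i \<in> V1")
    case True
    have "(\<Sum>j\<in>parcs G `` {i}. \<alpha> (i, j)) = (\<Sum>j\<in>V2. f (i, j))"
      using True fin V f(2) by (intro sum.mono_neutral_cong_left) (auto simp: \<alpha>_def R_def)
    then show ?thesis using f(3)[OF True] by simp
  next
    case False
    then have i2: "i \<in> V2" using i V(1) by blast
    have "f (j, i) = 0" if "j \<notin> parcs G `` {i}" for j
      using that f(2)[of "(j, i)"] arcs_symmetric unfolding R_def by blast
    then have "(\<Sum>j\<in>parcs G `` {i}. \<alpha> (i, j)) = (\<Sum>j\<in>V1. f (j, i))"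
      using False i2 fin V by (intro sum.mono_neutral_cong_left) (auto simp: \<alpha>_def)
    then show ?thesis using f(4)[OF i2] by simp
  qed
  have "M = weight_measure G \<alpha>"
  proof (rule measure_eqI_finite[OF setsM])
    show "sets (weight_measure G \<alpha>) = Pow (pverts G)"
      by (simp add: weight_measure_def sets_point_measure)
    show "finite (pverts G)" by (rule pair_finite_verts)
    show "emeasure M {i} = emeasure (weight_measure G \<alpha>) {i}" if i: "i \<in> pverts G" for i
    proof -
      have "emeasure (weight_measure G \<alpha>) {i} = ennreal (m i)"
        unfolding weight_measure_def using i pair_finite_verts
        by (subst emeasure_point_measure_finite) (auto simp: row)
      then show ?thesis
        by (simp add: m_def M.emeasure_eq_measure)
    qed
  qed
  then show ?thesis using \<alpha> by blast
qed

theorem mainTheorem2: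
  fixes G :: "'a pair_pre_digraph" and V1 V2 :: "'a set"
  assumes "pair_graph G"
    and "Digraph_Component.connected (with_proj G)"
    and "card (pverts G) \<ge> 2"
    and "bipartition G V1 V2"
  shows "N_B G V1 V2 = W G"
proof
  show "N_B G V1 V2 \<subseteq> W G"
    using N_B_imp_weight_measure[OF assms] by (auto simp: W_def)
  show "W G \<subseteq> N_B G V1 V2"
    using weight_measure_in_N_B[OF assms] by (auto simp: W_def)
qed

end
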